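(* Let $T \colon \mathfrak{A} \to \mathfrak{A}$ be a positive and unital linear operator on a unital $C^*$-algebra $\mathfrak{A}$. The following are equivalent: (a) $0 \notin \mathrm{Sp}(T)$ and the inverse operator $T^{-1}$ is positive. (b) The operator $T$ is a bijective isometry.
   Context: A linear operator $T$ on a $C^*$-algebra $\mathfrak{A}$ is positive if it maps the positive cone $\mathfrak{A}_+$ into $\mathfrak{A}_+$; it is unital if $T\mathbf{1} = \mathbf{1}$. $\mathrm{Sp}(T)$ denotes the spectrum of $T$ as a bounded linear operator on the Banach space $\mathfrak{A}$. *)

theory Defs
  imports "HOL-Analysis.Analysis"
begin

(* A unital complex C*-algebra. Through real_normed_algebra_1 the algebra is nonzero and
   norm 1 = 1; through banach it is complete. *)
class unital_cstar_algebra = real_normed_algebra_1 + banach +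
  fixes scaleC :: "complex \<Rightarrow> 'a \<Rightarrow> 'a" (infixr "*\<^sub>C" 75)
    and star :: "'a \<Rightarrow> 'a"
  assumes scaleR_scaleC: "scaleR r x = complex_of_real r *\<^sub>C x"
    and scaleC_add_right: "c *\<^sub>C (x + y) = c *\<^sub>C x + c *\<^sub>C y"
    and scaleC_add_left: "(c + d) *\<^sub>C x = c *\<^sub>C x + d *\<^sub>C x"
    and scaleC_scaleC: "c *\<^sub>C (d *\<^sub>C x) = (c * d) *\<^sub>C x"
    and scaleC_one: "1 *\<^sub>C x = x"
    and mult_scaleC_left: "(c *\<^sub>C x) * y = c *\<^sub>C (x * y)"
    and mult_scaleC_right: "x * (c *\<^sub>C y) = c *\<^sub>C (x * y)"
    and norm_scaleC: "norm (c *\<^sub>C x) = cmod c * norm x"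
    and star_add: "star (x + y) = star x + star y"
    and star_scaleC: "star (c *\<^sub>C x) = cnj c *\<^sub>C star x"
    and star_mult: "star (x * y) = star y * star x"
    and star_star: "star (star x) = x"
    and cstar_identity: "norm (star x * x) = (norm x)\<^sup>2"

global_interpretation complex_vector:
  vector_space "scaleC :: complex \<Rightarrow> 'a \<Rightarrow> 'a::unital_cstar_algebra"
  by standard (simp_all add: scaleC_add_right scaleC_add_left scaleC_scaleC scaleC_one)

definition clinear :: "('a::unital_cstar_algebra \<Rightarrow> 'a) \<Rightarrow> bool"
  where "clinear T \<longleftrightarrow> Vector_Spaces.linear scaleC scaleC T"

definition bounded_clinear :: "('a::unital_cstar_algebra \<Rightarrow> 'a) \<Rightarrow> bool"
  where "bounded_clinear T \<longleftrightarrow> clinear T \<and> (\<exists>K. \<forall>x. norm (T x) \<le> K * norm x)"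

definition elem_spectrum :: "'a::unital_cstar_algebra \<Rightarrow> complex set"
  where "elem_spectrum a =
    {z. \<not> (\<exists>b. b * (a - z *\<^sub>C 1) = 1 \<and> (a - z *\<^sub>C 1) * b = 1)}"

definition positive_cone :: "'a::unital_cstar_algebra set"
  where "positive_cone = {a. star a = a \<and> elem_spectrum a \<subseteq> complex_of_real ` {0..}}"

definition positive_operator :: "('a::unital_cstar_algebra \<Rightarrow> 'a) \<Rightarrow> bool"
  where "positive_operator T \<longleftrightarrow> clinear T \<and> T ` positive_cone \<subseteq> positive_cone"

definition unital_operator :: "('a::unital_cstar_algebra \<Rightarrow> 'a) \<Rightarrow> bool"
  where "unital_operator T \<longleftrightarrow> T 1 = 1"

(* The complex numbers z such that T - z has no inverse in the Banach algebra of bounded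
   complex-linear operators. *)
definition op_spectrum :: "('a::unital_cstar_algebra \<Rightarrow> 'a) \<Rightarrow> complex set"
  where "op_spectrum T =
    {z. \<not> (\<exists>S. bounded_clinear S \<and>
          S \<circ> (\<lambda>x. T x - z *\<^sub>C x) = id \<and> (\<lambda>x. T x - z *\<^sub>C x) \<circ> S = id)}"

definition isometry :: "('a::metric_space \<Rightarrow> 'b::metric_space) \<Rightarrow> bool"
  where "isometry f \<longleftrightarrow> (\<forall>x y. dist (f x) (f y) = dist x y)"

end

theory Submission
  imports Defs
begin

text \<open>Suppose that \<open>T\<close> and its inverse are positive.  Kadison's inequality \<open>T (a\<^sup>2) \<ge> (T a)\<^sup>2\<close> for
  self-adjoint \<open>a\<close>, applied to both maps, shows that \<open>T\<close> preserves squares, hence Jordan products and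
  the triple products \<open>x x\<^sup>* x\<close>.  Since \<open>\<parallel>x x\<^sup>* x\<parallel> = \<parallel>x\<parallel>\<^sup>3\<close>, iterating this cube turns any bound
  \<open>\<parallel>T x\<parallel> \<le> K \<parallel>x\<parallel>\<close> into \<open>\<parallel>T x\<parallel> \<le> \<parallel>x\<parallel>\<close>, and likewise for the inverse.  Kadison's inequality is
  proved by expanding \<open>a\<close> in Bernstein polynomials, which replaces the functional calculus.

  Conversely, a self-adjoint \<open>a\<close> is positive iff \<open>\<parallel>r - a\<parallel> \<le> r\<close> for \<open>r = \<parallel>a\<parallel>\<close>, and this condition is
  preserved by the inverse of a unital isometry.\<close>

section \<open>Invertible elements and spectra\<close>

lemma scaleC_scaleR: "complex_of_real r *\<^sub>C (x::'a::unital_cstar_algebra) = r *\<^sub>R x"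
  by (simp add: scaleR_scaleC)

lemma star_zero [simp]: "star (0::'a::unital_cstar_algebra) = 0"
  using star_add[of "0::'a" 0] by simp

lemma star_minus [simp]: "star (- x) = - star (x::'a::unital_cstar_algebra)"
  using star_add[of x "- x"] by (simp add: minus_unique)

lemma star_diff: "star (x - y) = star x - star (y::'a::unital_cstar_algebra)"
  using star_add[of x "- y"] by simp

lemma star_one [simp]: "star (1::'a::unital_cstar_algebra) = 1"
  by (metis star_star star_mult mult.right_neutral)

lemma star_scaleR [simp]: "star (r *\<^sub>R x) = r *\<^sub>R star (x::'a::unital_cstar_algebra)"
  by (simp add: scaleR_scaleC star_scaleC)

declare star_star [simp]

lemma norm_star [simp]: "norm (star x) = norm (x::'a::unital_cstar_algebra)"
proof -
  have le: "norm y \<le> norm (star y)" for y :: 'a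
  proof (cases "y = 0")
    case False
    have "norm y * norm y \<le> norm (star y) * norm y"
      using cstar_identity[of y] norm_mult_ineq[of "star y" y] by (simp add: power2_eq_square)
    then show ?thesis using False by simp
  qed simp
  show ?thesis using le[of x] le[of "star x"] by simp
qed

lemma bounded_linear_star: "bounded_linear (star :: 'a::unital_cstar_algebra \<Rightarrow> 'a)"
  by (rule bounded_linear_intro[where K=1]) (simp_all add: star_add)

lemma norm_square_selfadjoint:
  fixes x :: "'a::unital_cstar_algebra"
  assumes "star x = x"
  shows "norm (x * x) = (norm x)\<^sup>2"
  using cstar_identity[of x] assms by simp

definition inverse_pair :: "'a::monoid_mult \<Rightarrow> 'a \<Rightarrow> bool"
  where "inverse_pair x b \<longleftrightarrow> b * x = 1 \<and> x * b = 1"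

definition invertible_elem :: "'a::monoid_mult \<Rightarrow> bool"
  where "invertible_elem x \<longleftrightarrow> (\<exists>b. inverse_pair x b)"

lemma elem_spectrum_iff: "z \<in> elem_spectrum a \<longleftrightarrow> \<not> invertible_elem (a - z *\<^sub>C 1)"
  by (simp add: elem_spectrum_def invertible_elem_def inverse_pair_def)

lemma invertible_elem_one [simp]: "invertible_elem (1::'a::monoid_mult)"
  by (auto simp: invertible_elem_def inverse_pair_def)

lemma inverse_pair_mult:
  assumes "inverse_pair x b" "inverse_pair y c"
  shows "inverse_pair (x * y) (c * b)"
  using assms unfolding inverse_pair_def by (metis mult.assoc mult.left_neutral)

lemma invertible_elem_mult:
  "invertible_elem x \<Longrightarrow> invertible_elem y \<Longrightarrow> invertible_elem (x * y)"
  unfolding invertible_elem_def using inverse_pair_mult by blast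

text \<open>Commuting the factors turns the inverse of the product into a left and a right inverse
  of \<open>x\<close>, and these agree.\<close>

lemma invertible_elem_commuting_factor:
  assumes "invertible_elem (x * y)" "x * y = y * x"
  shows "invertible_elem x"
proof -
  obtain b where b: "b * (x * y) = 1" "x * y * b = 1"
    using assms(1) by (auto simp: invertible_elem_def inverse_pair_def)
  have l: "(b * y) * x = 1" using b(1) assms(2) by (simp add: mult.assoc)
  have r: "x * (y * b) = 1" using b(2) by (simp add: mult.assoc)
  have "b * y = y * b" by (metis l r mult.assoc mult.left_neutral mult.right_neutral)
  then show ?thesis using l r by (auto simp: invertible_elem_def inverse_pair_def)
qed

lemma inverse_pair_scaleC:
  fixes x :: "'a::unital_cstar_algebra"
  assumes "c \<noteq> 0" "inverse_pair x b"
  shows "inverse_pair (c *\<^sub>C x) (inverse c *\<^sub>C b)"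
  using assms by (simp add: inverse_pair_def mult_scaleC_left mult_scaleC_right scaleC_scaleC scaleC_one)

lemma invertible_elem_scaleC:
  fixes x :: "'a::unital_cstar_algebra"
  assumes "c \<noteq> 0" "invertible_elem x"
  shows "invertible_elem (c *\<^sub>C x)"
  using assms inverse_pair_scaleC unfolding invertible_elem_def by blast

lemma invertible_elem_scaleR:
  fixes x :: "'a::unital_cstar_algebra"
  assumes "c \<noteq> 0" "invertible_elem x"
  shows "invertible_elem (c *\<^sub>R x)"
  using invertible_elem_scaleC[of "complex_of_real c" x] assms by (simp add: scaleC_scaleR)

lemma invertible_elem_minus:
  fixes x :: "'a::unital_cstar_algebra"
  assumes "invertible_elem x"
  shows "invertible_elem (- x)"
  using invertible_elem_scaleR[of "-1" x] assms by simp

lemma inverse_pair_one_minus: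
  fixes y :: "'a::{real_normed_algebra_1,banach}"
  assumes "norm y < 1"
  obtains b where "inverse_pair (1 - y) b" "norm b \<le> 1 / (1 - norm y)"
proof -
  have sg: "summable (\<lambda>n. norm y ^ n)" using assms by (simp add: summable_geometric)
  have sn: "summable (\<lambda>n. norm (y ^ n))"
    by (rule summable_comparison_test'[OF sg, of 0]) (simp add: norm_power_ineq)
  have s: "summable (\<lambda>n. y ^ n)" by (rule summable_norm_cancel[OF sn])
  let ?b = "\<Sum>n. y ^ n"
  have sp: "?b - 1 = (\<Sum>n. y ^ Suc n)" using suminf_split_head[OF s] by simp
  have l: "?b * y = (\<Sum>n. y ^ Suc n)"
    by (simp add: suminf_mult2[OF s] power_Suc2 del: power_Suc)
  have r: "y * ?b = (\<Sum>n. y ^ Suc n)"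
    by (simp add: suminf_mult[OF s, symmetric])
  have "inverse_pair (1 - y) ?b"
    using l r sp by (simp add: inverse_pair_def algebra_simps)
  moreover have "norm ?b \<le> 1 / (1 - norm y)"
  proof -
    have "norm ?b \<le> (\<Sum>n. norm (y ^ n))" by (rule summable_norm[OF sn])
    also have "\<dots> \<le> (\<Sum>n. norm y ^ n)" by (rule suminf_le[OF _ sn sg]) (rule norm_power_ineq)
    also have "\<dots> = 1 / (1 - norm y)" using assms by (simp add: suminf_geometric)
    finally show ?thesis .
  qed
  ultimately show thesis by (rule that)
qed

lemma invertible_elem_minus_scaleC_one:
  fixes a :: "'a::unital_cstar_algebra"
  assumes "norm a < cmod z"
  shows "invertible_elem (a - z *\<^sub>C 1)"
proof -
  have z: "z \<noteq> 0" using assms by auto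
  have "norm (inverse z *\<^sub>C a) < 1"
    using assms z by (simp add: norm_scaleC norm_inverse inverse_eq_divide norm_divide mult.commute)
  then have "invertible_elem (1 - inverse z *\<^sub>C a)"
    by (metis inverse_pair_one_minus invertible_elem_def)
  then have "invertible_elem ((- z) *\<^sub>C (1 - inverse z *\<^sub>C a))"
    using z by (intro invertible_elem_scaleC) auto
  also have "(- z) *\<^sub>C (1 - inverse z *\<^sub>C a) = a - z *\<^sub>C 1"
    using z by (simp add: complex_vector.scale_right_diff_distrib scaleC_one)
  finally show ?thesis .
qed

lemma invertible_elem_plus_scaleR_one:
  fixes a :: "'a::unital_cstar_algebra"
  assumes "norm a < \<bar>t\<bar>"
  shows "invertible_elem (a + t *\<^sub>R 1)"
  using invertible_elem_minus_scaleC_one[of a "complex_of_real (- t)"] assms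
  by (simp add: scaleC_scaleR del: of_real_minus)

lemma scaleC_of_real_square:
  fixes x :: "'a::unital_cstar_algebra"
  shows "(complex_of_real t * complex_of_real t) *\<^sub>C x = t\<^sup>2 *\<^sub>R x"
  by (simp add: scaleR_scaleC power2_eq_square)

text \<open>Arens' trick: translating by \<open>i t\<close> moves a spectral value \<open>i \<beta>\<close> of \<open>a\<close> to
  \<open>i (\<beta> + t)\<close>, but increases the squared norm only to \<open>\<parallel>a\<parallel>\<^sup>2 + t\<^sup>2\<close>.\<close>

lemma invertible_elem_selfadjoint_minus_imaginary:
  fixes a :: "'a::unital_cstar_algebra"
  assumes sa: "star a = a" and "\<beta> \<noteq> 0"
  shows "invertible_elem (a - (\<i> * complex_of_real \<beta>) *\<^sub>C 1)"
proof -
  \<comment> \<open>Solves \<open>2 * \<beta> * t = (norm a)\<^sup>2 + 1\<close>, so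
    \<open>(\<beta> + t)\<^sup>2\<close> exceeds \<open>(norm a)\<^sup>2 + t\<^sup>2\<close> by
    \<open>\<beta>\<^sup>2 + 1\<close>.\<close>
  define t where "t = ((norm a)\<^sup>2 + 1) / (2 * \<beta>)"
  let ?c = "\<i> * complex_of_real t"
  have st: "star (a + ?c *\<^sub>C 1) = a - ?c *\<^sub>C 1"
    by (simp add: star_add sa star_scaleC)
  have "star (a + ?c *\<^sub>C 1) * (a + ?c *\<^sub>C 1) = a * a + t\<^sup>2 *\<^sub>R 1"
    unfolding st by (simp add: algebra_simps mult_scaleC_left mult_scaleC_right scaleC_of_real_square)
  then have "(norm (a + ?c *\<^sub>C 1))\<^sup>2 = norm (a * a + t\<^sup>2 *\<^sub>R 1)"
    by (metis cstar_identity)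
  also have "\<dots> \<le> (norm a)\<^sup>2 + t\<^sup>2"
    by (rule order.trans[OF norm_triangle_ineq]) (simp add: norm_square_selfadjoint[OF sa])
  also have "\<dots> < (\<beta> + t)\<^sup>2"
    using assms(2) by (simp add: power2_sum t_def add_pos_nonneg)
  finally have "norm (a + ?c *\<^sub>C 1) < cmod (\<i> * complex_of_real (\<beta> + t))"
    by (metis norm_mult norm_ii mult_1 norm_of_real power2_abs power_less_imp_less_base abs_ge_zero)
  from invertible_elem_minus_scaleC_one[OF this] show ?thesis
    by (simp add: algebra_simps scaleC_add_left)
qed

lemma elem_spectrum_selfadjoint_real:
  fixes a :: "'a::unital_cstar_algebra"
  assumes sa: "star a = a" and z: "z \<in> elem_spectrum a"
  shows "z = complex_of_real (Re z)"
proof (rule ccontr)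
  assume "\<not> ?thesis"
  then have im: "Im z \<noteq> 0" by (simp add: complex_eq_iff)
  have "star (a - Re z *\<^sub>R 1) = a - Re z *\<^sub>R 1" by (simp add: star_diff sa)
  from invertible_elem_selfadjoint_minus_imaginary[OF this im]
  have "invertible_elem (a - (complex_of_real (Re z) *\<^sub>C 1 + (\<i> * complex_of_real (Im z)) *\<^sub>C 1))"
    by (simp add: scaleR_scaleC algebra_simps)
  then have "invertible_elem (a - z *\<^sub>C 1)"
    by (simp add: scaleC_add_left[symmetric] complex_eq[symmetric])
  with z show False by (simp add: elem_spectrum_iff)
qed

text \<open>Spectra of self-adjoint elements are real, so only negative reals have to be excluded.
  This is the working form of positivity below.\<close>

lemma positive_cone_iff:
  fixes a :: "'a::unital_cstar_algebra"
  shows "a \<in> positive_cone \<longleftrightarrow> star a = a \<and> (\<forall>t>0. invertible_elem (a + t *\<^sub>R 1))"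
proof safe
  assume "a \<in> positive_cone"
  then show "star a = a" by (simp add: positive_cone_def)
  fix t :: real assume "t > 0"
  show "invertible_elem (a + t *\<^sub>R 1)"
  proof (rule ccontr)
    assume "\<not> ?thesis"
    then have "complex_of_real (- t) \<in> elem_spectrum a"
      unfolding elem_spectrum_iff scaleC_scaleR by simp
    then have "complex_of_real (- t) \<in> complex_of_real ` {0..}"
      using \<open>a \<in> positive_cone\<close> unfolding positive_cone_def by blast
    then show False using \<open>t > 0\<close> by (auto simp del: of_real_minus)
  qed
next
  assume sa: "star a = a" and inv: "\<forall>t>0. invertible_elem (a + t *\<^sub>R 1)"
  have "z \<in> complex_of_real ` {0..}" if z: "z \<in> elem_spectrum a" for z
  proof -
    note zr = elem_spectrum_selfadjoint_real[OF sa z]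
    have "\<not> invertible_elem (a + (- Re z) *\<^sub>R 1)"
      using z zr unfolding elem_spectrum_iff by (metis scaleC_scaleR scaleR_minus_left diff_conv_add_uminus)
    then have "Re z \<ge> 0" using inv by (metis neg_0_less_iff_less not_le)
    then show ?thesis using zr by (metis atLeast_iff imageI)
  qed
  with sa show "a \<in> positive_cone" by (auto simp: positive_cone_def)
qed

lemma positive_cone_selfadjoint: "a \<in> positive_cone \<Longrightarrow> star a = a"
  by (simp add: positive_cone_iff)

text \<open>\<open>h * h + t\<close> factors as
  \<open>(h - \<i> sqrt t) * (h + \<i> sqrt t)\<close>, and Arens' trick makes both factors
  invertible.\<close>

lemma positive_cone_square:
  fixes h :: "'a::unital_cstar_algebra"
  assumes sa: "star h = h"
  shows "h * h \<in> positive_cone"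
  unfolding positive_cone_iff
proof (intro conjI allI impI)
  show "star (h * h) = h * h" by (simp add: star_mult sa)
  fix t :: real assume "t > 0"
  then have r: "sqrt t \<noteq> 0" "- sqrt t \<noteq> 0" by auto
  let ?c = "\<i> * complex_of_real (sqrt t)"
  have "invertible_elem ((h - ?c *\<^sub>C 1) * (h + ?c *\<^sub>C 1))"
    using invertible_elem_selfadjoint_minus_imaginary[OF sa r(1)]
      invertible_elem_selfadjoint_minus_imaginary[OF sa r(2)]
    by (intro invertible_elem_mult) auto
  also have "(h - ?c *\<^sub>C 1) * (h + ?c *\<^sub>C 1) = h * h + t *\<^sub>R 1"
    using \<open>t > 0\<close> by (simp add: algebra_simps mult_scaleC_left mult_scaleC_right scaleC_of_real_square)
  finally show "invertible_elem (h * h + t *\<^sub>R 1)" .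
qed

section \<open>Norm and spectrum of self-adjoint elements\<close>

lemma inverse_pair_diff_bound:
  fixes x y :: "'a::real_normed_algebra_1"
  assumes "inverse_pair x b" "inverse_pair y c"
  shows "norm (b - c) \<le> norm b * norm (y - x) * norm c"
proof -
  have "b * (y - x) * c = b * (y * c) - (b * x) * c" by (simp add: algebra_simps)
  also have "\<dots> = b - c" using assms by (simp add: inverse_pair_def)
  finally have "norm (b - c) \<le> norm (b * (y - x)) * norm c" using norm_mult_ineq[of "b * (y - x)" c] by simp
  also have "\<dots> \<le> norm b * norm (y - x) * norm c"
    by (intro mult_right_mono norm_mult_ineq) auto
  finally show ?thesis .
qed

text \<open>In \<open>y = x * (1 - b * (x - y))\<close> the second factor is within 1/2 of 1, so its
  Neumann series has norm at most 2.\<close>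

lemma inverse_pair_local_bound:
  fixes x :: "'a::{real_normed_algebra_1,banach}"
  assumes x: "inverse_pair x b" and y: "norm (x - y) * norm b \<le> 1 / 2"
  obtains c where "inverse_pair y c" "norm c \<le> 2 * norm b"
proof -
  have n: "norm (b * (x - y)) \<le> 1 / 2"
    using norm_mult_ineq[of b "x - y"] y by (simp add: mult.commute)
  then obtain d where d: "inverse_pair (1 - b * (x - y)) d" "norm d \<le> 1 / (1 - norm (b * (x - y)))"
    using inverse_pair_one_minus[of "b * (x - y)"] by force
  have "1 / (1 - norm (b * (x - y))) \<le> 2" using n by (simp add: divide_simps)
  then have "norm d \<le> 2" using d(2) by linarith
  moreover have "norm (d * b) \<le> norm d * norm b" by (rule norm_mult_ineq)
  ultimately have "norm (d * b) \<le> 2 * norm b"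
    by (meson mult_right_mono norm_ge_zero order_trans)
  moreover have "x * (1 - b * (x - y)) = y"
    using x by (simp add: inverse_pair_def algebra_simps flip: mult.assoc)
  then have "inverse_pair y (d * b)" using inverse_pair_mult[OF x d(1)] by simp
  ultimately show thesis using that by blast
qed

text \<open>The local bound holds on a disc around each \<open>w\<close>, and finitely many of these
  discs cover the compact unit disc.\<close>

lemma uniform_resolvent_bound:
  fixes x :: "'a::unital_cstar_algebra"
  assumes inv: "\<And>w. cmod w \<le> 1 \<Longrightarrow> invertible_elem (1 - w *\<^sub>C x)"
  obtains M where "\<And>w. cmod w \<le> 1 \<Longrightarrow> \<exists>c. inverse_pair (1 - w *\<^sub>C x) c \<and> norm c \<le> M"
proof -
  define B where "B w M \<longleftrightarrow> (\<exists>c. inverse_pair (1 - w *\<^sub>C x) c \<and> norm c \<le> M)" for w M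
  have Bmono: "B w M \<Longrightarrow> M \<le> N \<Longrightarrow> B w N" for w M N unfolding B_def by force
  have loc: "\<exists>e>0. \<exists>M. \<forall>v\<in>ball w e. B v M" if w: "w \<in> cball 0 1" for w
  proof -
    obtain b where b: "inverse_pair (1 - w *\<^sub>C x) b"
      using inv[of w] w by (auto simp: invertible_elem_def)
    define e where "e = 1 / (2 * (norm x * norm b + 1))"
    have p: "norm x * norm b + 1 > 0" by (simp add: add_nonneg_pos)
    have "B v (2 * norm b)" if "v \<in> ball w e" for v
    proof -
      have "(1 - w *\<^sub>C x) - (1 - v *\<^sub>C x) = (v - w) *\<^sub>C x"
        by (simp add: complex_vector.scale_left_diff_distrib)
      then have "norm ((1 - w *\<^sub>C x) - (1 - v *\<^sub>C x)) * norm b = cmod (v - w) * (norm x * norm b)"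
        by (simp add: norm_scaleC)
      also have "\<dots> \<le> e * (norm x * norm b)"
        using that by (intro mult_right_mono) (auto simp: dist_norm norm_minus_commute)
      also have "\<dots> \<le> 1 / 2" using p by (simp add: e_def divide_simps)
      finally show ?thesis using inverse_pair_local_bound[OF b] unfolding B_def by metis
    qed
    moreover have "e > 0" using p by (simp add: e_def)
    ultimately show ?thesis by blast
  qed
  then obtain e M where e: "\<And>w. w \<in> cball 0 1 \<Longrightarrow> e w > 0"
    and M: "\<And>w v. w \<in> cball 0 1 \<Longrightarrow> v \<in> ball w (e w) \<Longrightarrow> B v (M w)"
    by metis
  obtain C where C: "C \<subseteq> cball 0 1" "finite C" "cball 0 1 \<subseteq> (\<Union>w\<in>C. ball w (e w))"
    by (rule compactE_image[of "cball (0::complex) 1" "cball 0 1" "\<lambda>w. ball w (e w)"])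
       (use e in \<open>auto intro!: bexI[of _ _]\<close>)
  show thesis
  proof (rule that)
    fix w :: complex assume "cmod w \<le> 1"
    then have "w \<in> cball 0 1" by simp
    then obtain v where v: "v \<in> C" "w \<in> ball v (e v)" using C(3) by blast
    have "M v \<le> Max (M ` C)" using v C(2) by simp
    then have "B w (Max (M ` C))" using M[of v w] v C(1) Bmono by blast
    then show "\<exists>c. inverse_pair (1 - w *\<^sub>C x) c \<and> norm c \<le> Max (M ` C)" unfolding B_def .
  qed
qed

text \<open>Partial fractions: \<open>1 / (1 - y\<^sup>2)\<close> is the mean of
  \<open>1 / (1 - y)\<close> and \<open>1 / (1 + y)\<close>.\<close>

lemma inverse_pair_one_minus_square:
  fixes y :: "'a::unital_cstar_algebra"
  assumes "inverse_pair (1 - y) c" "inverse_pair (1 + y) d"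
  shows "inverse_pair (1 - y * y) ((1 / 2) *\<^sub>R (c + d))"
proof -
  have f: "1 - y * y = (1 + y) * (1 - y)" "1 - y * y = (1 - y) * (1 + y)" by (simp_all add: algebra_simps)
  have "c * (1 - y * y) = 1 + y" "(1 - y * y) * c = 1 + y"
    using assms(1) f unfolding inverse_pair_def by (metis mult.assoc mult.left_neutral mult.right_neutral)+
  moreover have "d * (1 - y * y) = 1 - y" "(1 - y * y) * d = 1 - y"
    using assms(2) f unfolding inverse_pair_def by (metis mult.assoc mult.left_neutral mult.right_neutral)+
  moreover have "(1 / 2) *\<^sub>R (1 + y + (1 - y)) = 1"
    by (simp flip: scaleR_2)
  ultimately show ?thesis
    by (simp only: inverse_pair_def mult_scaleR_left mult_scaleR_right distrib_left distrib_right)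
qed

text \<open>The resolvents at the \<open>2\<^sup>k\<close>-th roots of \<open>w\<close> average to the resolvent of \<open>x\<close> to the
  power \<open>2\<^sup>k\<close> at \<open>w\<close>, so a modulus of continuity of the resolvent passes to all these powers.\<close>

lemma resolvent_power_diff_bound:
  fixes x :: "'a::unital_cstar_algebra" and s L :: real
  assumes "\<And>w. cmod w = 1 \<Longrightarrow> \<exists>c d. inverse_pair (1 - w *\<^sub>C x) c
      \<and> inverse_pair (1 - s *\<^sub>R w *\<^sub>C x) d \<and> norm (c - d) \<le> L"
    and "cmod w = 1"
  shows "\<exists>c d. inverse_pair (1 - w *\<^sub>C x ^ 2 ^ k) c
      \<and> inverse_pair (1 - s ^ 2 ^ k *\<^sub>R w *\<^sub>C x ^ 2 ^ k) d \<and> norm (c - d) \<le> L"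
  using assms(2)
proof (induction k arbitrary: w)
  case 0
  then show ?case using assms(1) by simp
next
  case (Suc k)
  define v where "v = csqrt w"
  have v: "v * v = w" by (simp add: v_def flip: power2_eq_square)
  have nv: "cmod v = 1" using Suc.prems v by (metis norm_mult norm_ge_zero power2_eq_square power2_eq_1_iff
        abs_of_nonneg abs_1 power2_eq_iff_nonneg one_power2 zero_le_one)
  define y where "y = v *\<^sub>C x ^ 2 ^ k"
  define s' where "s' = s ^ 2 ^ k"
  obtain c1 d1 where 1: "inverse_pair (1 - y) c1" "inverse_pair (1 - s' *\<^sub>R y) d1" "norm (c1 - d1) \<le> L"
    using Suc.IH[OF nv] unfolding y_def s'_def by blast
  obtain c2 d2 where 2: "inverse_pair (1 + y) c2" "inverse_pair (1 + s' *\<^sub>R y) d2" "norm (c2 - d2) \<le> L"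
    using Suc.IH[of "- v"] nv unfolding y_def s'_def by auto
  have sq: "y * y = w *\<^sub>C x ^ 2 ^ Suc k"
    by (simp add: y_def mult_scaleC_left mult_scaleC_right scaleC_scaleC v mult_2 power_add)
  then have sq': "(s' *\<^sub>R y) * (s' *\<^sub>R y) = s ^ 2 ^ Suc k *\<^sub>R w *\<^sub>C x ^ 2 ^ Suc k"
    by (simp add: s'_def mult_2 power_add)
  have "norm ((1 / 2) *\<^sub>R (c1 + c2) - (1 / 2) *\<^sub>R (d1 + d2)) = (1 / 2) * norm ((c1 - d1) + (c2 - d2))"
    by (simp flip: scaleR_diff_right add: add_diff_add)
  also have "\<dots> \<le> L" using norm_triangle_ineq[of "c1 - d1" "c2 - d2"] 1(3) 2(3) by simp
  finally show ?case
    using inverse_pair_one_minus_square[OF 1(1) 2(1)] inverse_pair_one_minus_square[OF 1(2) 2(2)]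
    unfolding sq sq' by blast
qed

lemma norm_power_selfadjoint:
  fixes x :: "'a::unital_cstar_algebra"
  assumes "star x = x"
  shows "star (x ^ 2 ^ k) = x ^ 2 ^ k \<and> norm (x ^ 2 ^ k) = norm x ^ 2 ^ k"
proof (induction k)
  case (Suc k)
  have "x ^ 2 ^ Suc k = x ^ 2 ^ k * x ^ 2 ^ k" by (simp add: mult_2 power_add)
  then show ?case using Suc norm_square_selfadjoint[of "x ^ 2 ^ k"]
    by (simp add: star_mult power2_eq_square mult_2 power_add)
qed (simp add: assms)

text \<open>This does the work of the spectral radius formula without complex analysis. If 1 and -1
  were both outside the spectrum, the resolvent would be bounded on the closed disc and vary little
  between \<open>w\<close> and \<open>s * w\<close> on the circle. This passes to
  \<open>X = x ^ 2 ^ m\<close>, still of norm 1, whose resolvent at the tiny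
  \<open>s ^ 2 ^ m\<close> is nearly 1. So its resolvent at 1 is nearly 1 as well, which forces
  \<open>X\<close> to be small.\<close>

lemma norm_one_selfadjoint_not_both_invertible:
  fixes x :: "'a::unital_cstar_algebra"
  assumes sa: "star x = x" and n: "norm x = 1"
    and inv: "invertible_elem (1 - x)" "invertible_elem (1 + x)"
  shows False
proof -
  \<comment> \<open>Otherwise \<open>inverse w\<close> is a spectral value, hence real, of modulus
    at least 1 and at most \<open>norm x = 1\<close>. So it is 1 or -1, and both are
    excluded.\<close>
  have iw: "invertible_elem (1 - w *\<^sub>C x)" if w: "cmod w \<le> 1" for w
  proof (cases "w = 0")
    case False
    have "invertible_elem (x - inverse w *\<^sub>C 1)"
    proof (rule ccontr)
      assume ni: "\<not> ?thesis"
      then have "inverse w \<in> elem_spectrum x" by (simp add: elem_spectrum_iff)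
      from elem_spectrum_selfadjoint_real[OF sa this] obtain r where r: "inverse w = complex_of_real r" by blast
      have "\<not> norm x < cmod (inverse w)" using ni invertible_elem_minus_scaleC_one by blast
      then have "\<bar>r\<bar> \<le> 1" using n r by simp
      moreover have "\<bar>r\<bar> \<ge> 1"
      proof -
        have "cmod (inverse w) \<ge> 1" using w False by (simp add: norm_inverse one_le_inverse)
        then show ?thesis using r by simp
      qed
      ultimately have "r = 1 \<or> r = -1" by linarith
      then have "invertible_elem (x - r *\<^sub>R 1)"
        using invertible_elem_minus[OF inv(1)] inv(2) by (auto simp: add.commute)
      then show False using ni r by (simp add: scaleC_scaleR)
    qed
    then have "invertible_elem ((- w) *\<^sub>C (x - inverse w *\<^sub>C 1))"
      using False by (intro invertible_elem_scaleC) auto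
    also have "(- w) *\<^sub>C (x - inverse w *\<^sub>C 1) = 1 - w *\<^sub>C x"
      using False by (simp add: complex_vector.scale_right_diff_distrib scaleC_one)
    finally show ?thesis .
  qed simp
  obtain M0 where M0: "\<And>w. cmod w \<le> 1 \<Longrightarrow> \<exists>c. inverse_pair (1 - w *\<^sub>C x) c \<and> norm c \<le> M0"
    using uniform_resolvent_bound[OF iw] by blast
  define M where "M = max M0 1"
  have M: "\<exists>c. inverse_pair (1 - w *\<^sub>C x) c \<and> norm c \<le> M" if "cmod w \<le> 1" for w
    using M0[OF that] unfolding M_def by force
  have "M \<ge> 1" by (simp add: M_def)
  \<comment> \<open>Chosen so that the resolvent identity bounds the variation by
    \<open>M * (1 - s) * M = 1 / 6\<close>; \<open>M \<ge> 1\<close> keeps \<open>s\<close> between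
    0 and 1.\<close>
  define s where "s = 1 - 1 / (6 * M\<^sup>2)"
  have M2: "M\<^sup>2 \<ge> 1" using \<open>M \<ge> 1\<close> by (simp add: one_le_power)
  have s: "0 < s" "s < 1" and sM: "M * (1 - s) * M = 1 / 6"
  proof -
    have "1 / (6 * M\<^sup>2) \<le> 1 / 6" "1 / (6 * M\<^sup>2) > 0" using M2 \<open>M \<ge> 1\<close> by (simp_all add: divide_simps)
    then show "0 < s" "s < 1" unfolding s_def by linarith+
    have "M * (1 - s) * M = M\<^sup>2 * (1 / (6 * M\<^sup>2))" unfolding s_def power2_eq_square by (simp add: mult.commute mult.left_commute)
    also have "\<dots> = 1 / 6" using \<open>M \<ge> 1\<close> by (simp add: divide_simps)
    finally show "M * (1 - s) * M = 1 / 6" .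
  qed
  have base: "\<exists>c d. inverse_pair (1 - w *\<^sub>C x) c \<and> inverse_pair (1 - s *\<^sub>R w *\<^sub>C x) d \<and> norm (c - d) \<le> 1 / 6"
    if w: "cmod w = 1" for w
  proof -
    obtain c where c: "inverse_pair (1 - w *\<^sub>C x) c" "norm c \<le> M" using M w by force
    have "cmod (complex_of_real s * w) \<le> 1" using s w by (simp add: norm_mult)
    from M[OF this] obtain d where d: "inverse_pair (1 - s *\<^sub>R w *\<^sub>C x) d" "norm d \<le> M"
      unfolding scaleC_scaleC[symmetric] scaleC_scaleR by blast
    have "(1 - s *\<^sub>R w *\<^sub>C x) - (1 - w *\<^sub>C x) = (1 - s) *\<^sub>R w *\<^sub>C x"
      by (simp add: scaleR_left_diff_distrib)
    then have "norm ((1 - s *\<^sub>R w *\<^sub>C x) - (1 - w *\<^sub>C x)) = 1 - s"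
      using s w n by (simp add: norm_scaleC)
    then have "norm (c - d) \<le> norm c * (1 - s) * norm d"
      using inverse_pair_diff_bound[OF c(1) d(1)] by simp
    also have "\<dots> \<le> M * (1 - s) * M"
      using c(2) d(2) s \<open>M \<ge> 1\<close> by (intro mult_mono) auto
    finally show ?thesis using c(1) d(1) sM by auto
  qed
  \<comment> \<open>The value 1/7 gives \<open>norm d \<le> 7 / 6\<close> and
    \<open>norm (d - 1) \<le> 1 / 6\<close>. Adding the variation 1/6 yields
    \<open>norm (c - 1) \<le> 1 / 3\<close> and finally \<open>norm X \<le> 2 / 3\<close>.\<close>
  obtain m where m: "s ^ m < 1 / 7" using real_arch_pow_inv[of "1/7" s] s by auto
  have "m \<le> 2 ^ m" by (simp add: less_imp_le)
  then have sm: "s ^ 2 ^ m < 1 / 7" using m s power_decreasing[of m "2 ^ m" s] by linarith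
  define X where "X = x ^ 2 ^ m"
  have nX: "norm X = 1" using norm_power_selfadjoint[OF sa] n by (simp add: X_def)
  obtain c d where c: "inverse_pair (1 - X) c" and d: "inverse_pair (1 - s ^ 2 ^ m *\<^sub>R X) d"
    and cd: "norm (c - d) \<le> 1 / 6"
    using resolvent_power_diff_bound[of x s "1/6" 1 m, OF base] by (auto simp: X_def scaleC_one)
  define e where "e = s ^ 2 ^ m *\<^sub>R X"
  have ne: "norm e < 1 / 7" using sm s nX by (simp add: e_def)
  obtain d' where d': "inverse_pair (1 - e) d'" "norm d' \<le> 1 / (1 - norm e)"
    using inverse_pair_one_minus[of e] ne by force
  have "d' = d" using d' (1) d unfolding e_def inverse_pair_def
    by (metis mult.assoc mult.left_neutral mult.right_neutral)
  have "1 / (1 - norm e) \<le> 7 / 6" using ne by (simp add: divide_simps)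
  then have nd: "norm d \<le> 7 / 6" using d'(2) \<open>d' = d\<close> by simp
  have "d - 1 = d * e" using d by (simp add: inverse_pair_def e_def algebra_simps)
  then have "norm (d - 1) \<le> 7 / 6 * (1 / 7)"
    using norm_mult_ineq[of d e] mult_mono[OF nd less_imp_le[OF ne]] by simp
  then have c1: "norm (c - 1) \<le> 1 / 3"
    using norm_triangle_ineq[of "c - d" "d - 1"] cd by simp
  have "X = (1 - X) * (c - 1)" using c by (simp add: inverse_pair_def algebra_simps)
  then have "norm X \<le> norm (1 - X) * norm (c - 1)" by (metis norm_mult_ineq)
  also have "\<dots> \<le> 2 * (1 / 3)"
    using c1 norm_triangle_ineq4[of 1 X] nX by (intro mult_mono) auto
  finally show False using nX by simp
qed

section \<open>The positive cone\<close>

text \<open>If \<open>t = norm b\<close> exceeded \<open>r\<close>, then \<open>t - b\<close> and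
  \<open>t + b\<close> would both be invertible; dividing by \<open>t\<close> contradicts the
  previous lemma.\<close>

lemma selfadjoint_norm_le:
  fixes b :: "'a::unital_cstar_algebra"
  assumes sa: "star b = b" and "0 \<le> r"
    and pos: "r *\<^sub>R 1 - b \<in> positive_cone" "r *\<^sub>R 1 + b \<in> positive_cone"
  shows "norm b \<le> r"
proof (rule ccontr)
  assume nle: "\<not> ?thesis"
  define t where "t = norm b"
  have t: "t > r" "t > 0" using nle \<open>0 \<le> r\<close> by (auto simp: t_def)
  have "invertible_elem ((r *\<^sub>R 1 - b) + (t - r) *\<^sub>R 1)" "invertible_elem ((r *\<^sub>R 1 + b) + (t - r) *\<^sub>R 1)"
    using pos t unfolding positive_cone_iff by auto
  then have "invertible_elem (inverse t *\<^sub>R ((r *\<^sub>R 1 - b) + (t - r) *\<^sub>R 1))"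
      "invertible_elem (inverse t *\<^sub>R ((r *\<^sub>R 1 + b) + (t - r) *\<^sub>R 1))"
    using t by (auto intro!: invertible_elem_scaleR)
  moreover have "inverse t *\<^sub>R ((r *\<^sub>R 1 - b) + (t - r) *\<^sub>R 1) = 1 - inverse t *\<^sub>R b"
      "inverse t *\<^sub>R ((r *\<^sub>R 1 + b) + (t - r) *\<^sub>R 1) = 1 + inverse t *\<^sub>R b"
    using t by (simp_all add: algebra_simps)
  moreover have "norm (inverse t *\<^sub>R b) = 1" using t by (simp add: t_def)
  ultimately show False using norm_one_selfadjoint_not_both_invertible[of "inverse t *\<^sub>R b"] sa by simp
qed

lemma positive_cone_scalar_plus_selfadjoint:
  fixes a :: "'a::unital_cstar_algebra"
  assumes "star a = a" "norm a \<le> r"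
  shows "r *\<^sub>R 1 + a \<in> positive_cone"
  unfolding positive_cone_iff
proof (intro conjI allI impI)
  show "star (r *\<^sub>R 1 + a) = r *\<^sub>R 1 + a" using assms by (simp add: star_add)
  fix t :: real assume "t > 0"
  moreover have "0 \<le> r" using assms(2) norm_ge_zero[of a] by linarith
  ultimately have "invertible_elem (a + (r + t) *\<^sub>R 1)"
    using assms(2) by (intro invertible_elem_plus_scaleR_one) auto
  then show "invertible_elem (r *\<^sub>R 1 + a + t *\<^sub>R 1)" by (simp add: algebra_simps)
qed

text \<open>Trades the spectral condition for a metric one, from which closure under sums and
  transport by isometries follow. Forward, \<open>r - a\<close> lies between \<open>- r\<close> and
  \<open>r\<close> because \<open>a\<close> and \<open>2 r - a\<close> are positive.\<close>

lemma positive_cone_norm_iff: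
  fixes a :: "'a::unital_cstar_algebra"
  assumes "norm a \<le> r"
  shows "a \<in> positive_cone \<longleftrightarrow> star a = a \<and> norm (r *\<^sub>R 1 - a) \<le> r"
proof
  assume a: "a \<in> positive_cone"
  note sa = positive_cone_selfadjoint[OF a]
  have r: "0 \<le> r" using assms norm_ge_zero[of a] by linarith
  have "norm (r *\<^sub>R 1 - a) \<le> r"
  proof (rule selfadjoint_norm_le)
    show "star (r *\<^sub>R 1 - a) = r *\<^sub>R 1 - a" by (simp add: star_diff sa)
    show "r *\<^sub>R 1 - (r *\<^sub>R 1 - a) \<in> positive_cone" using a by simp
    have "(2 * r) *\<^sub>R 1 + - a \<in> positive_cone"
      using sa assms r by (intro positive_cone_scalar_plus_selfadjoint) auto
    also have "(2 * r) *\<^sub>R 1 + - a = r *\<^sub>R 1 + (r *\<^sub>R 1 - a)"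
      unfolding mult_2 scaleR_add_left by simp
    finally show "r *\<^sub>R 1 + (r *\<^sub>R 1 - a) \<in> positive_cone" .
  qed (rule r)
  with sa show "star a = a \<and> norm (r *\<^sub>R 1 - a) \<le> r" ..
next
  assume "star a = a \<and> norm (r *\<^sub>R 1 - a) \<le> r"
  then have "r *\<^sub>R 1 + - (r *\<^sub>R 1 - a) \<in> positive_cone"
    by (intro positive_cone_scalar_plus_selfadjoint) (auto simp: star_diff norm_minus_commute)
  then show "a \<in> positive_cone" by simp
qed

lemma positive_cone_add:
  fixes a b :: "'a::unital_cstar_algebra"
  assumes "a \<in> positive_cone" "b \<in> positive_cone"
  shows "a + b \<in> positive_cone"
proof -
  have "norm (norm a *\<^sub>R 1 - a) \<le> norm a" "norm (norm b *\<^sub>R 1 - b) \<le> norm b"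
    using assms positive_cone_norm_iff by blast+
  moreover have "(norm a + norm b) *\<^sub>R 1 - (a + b) = (norm a *\<^sub>R 1 - a) + (norm b *\<^sub>R 1 - b)"
    by (simp add: algebra_simps)
  ultimately have "norm ((norm a + norm b) *\<^sub>R 1 - (a + b)) \<le> norm a + norm b"
    by (metis add_mono norm_triangle_le)
  then show ?thesis using assms[THEN positive_cone_selfadjoint]
    by (subst positive_cone_norm_iff[of _ "norm a + norm b"]) (auto simp: norm_triangle_ineq star_add)
qed

lemma positive_cone_scaleR:
  fixes a :: "'a::unital_cstar_algebra"
  assumes "a \<in> positive_cone" "0 \<le> r"
  shows "r *\<^sub>R a \<in> positive_cone"
proof (cases "r = 0")
  case False
  then have r: "r > 0" using assms by simp
  have "invertible_elem (r *\<^sub>R a + t *\<^sub>R 1)" if "t > 0" for t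
  proof -
    have "invertible_elem (a + (t / r) *\<^sub>R 1)" using that r assms by (simp add: positive_cone_iff)
    then have "invertible_elem (r *\<^sub>R (a + (t / r) *\<^sub>R 1))" using r by (intro invertible_elem_scaleR) auto
    then show ?thesis using r by (simp add: scaleR_add_right)
  qed
  then show ?thesis using assms by (simp add: positive_cone_iff)
qed (use positive_cone_square[of 0] in simp)

lemma positive_cone_one [simp]: "(1::'a::unital_cstar_algebra) \<in> positive_cone"
  using positive_cone_square[of 1] by simp

lemma positive_cone_antisym:
  fixes a :: "'a::unital_cstar_algebra"
  assumes "a \<in> positive_cone" "- a \<in> positive_cone"
  shows "a = 0"
  using selfadjoint_norm_le[of a 0] assms positive_cone_selfadjoint by auto

lemma positive_cone_closed:
  fixes a :: "'a::unital_cstar_algebra"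
  assumes "\<And>e. e > 0 \<Longrightarrow> a + e *\<^sub>R 1 \<in> positive_cone"
  shows "a \<in> positive_cone"
  unfolding positive_cone_iff
proof (intro conjI allI impI)
  show "star a = a" using positive_cone_selfadjoint[OF assms[of 1]] by (simp add: star_add)
  fix t :: real assume "t > 0"
  then have "invertible_elem (a + (t / 2) *\<^sub>R 1 + (t / 2) *\<^sub>R 1)"
    using assms[of "t/2"] unfolding positive_cone_iff by simp
  then show "invertible_elem (a + t *\<^sub>R 1)"
    by (simp add: add.assoc flip: scaleR_add_left)
qed

text \<open>The error \<open>e *\<^sub>R b\<close> is absorbed by a small multiple of 1, as
  \<open>e - d b\<close> is positive once \<open>d * norm b \<le> e\<close>. Serves to remove the
  regularising terms in later arguments.\<close>

lemma positive_cone_limit: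
  fixes a b :: "'a::unital_cstar_algebra"
  assumes sa: "star b = b" and pos: "\<And>e. e > 0 \<Longrightarrow> a + e *\<^sub>R b \<in> positive_cone"
  shows "a \<in> positive_cone"
proof (rule positive_cone_closed)
  fix e :: real assume "e > 0"
  define d where "d = e / (norm b + 1)"
  have p: "norm b + 1 > 0" by (simp add: add_nonneg_pos)
  then have d: "d > 0" using \<open>e > 0\<close> by (simp add: d_def)
  have "norm (- (d *\<^sub>R b)) \<le> e" using p d \<open>e > 0\<close> by (simp add: d_def divide_simps)
  then have "e *\<^sub>R 1 + - (d *\<^sub>R b) \<in> positive_cone"
    using sa by (intro positive_cone_scalar_plus_selfadjoint) auto
  from positive_cone_add[OF pos[OF d] this] show "a + e *\<^sub>R 1 \<in> positive_cone"
    by (simp add: algebra_simps)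
qed

section \<open>Positivity of \<open>star x * x\<close>\<close>

lemma invertible_elem_swap:
  fixes x y :: "'a::unital_cstar_algebra"
  assumes "invertible_elem (x * y + t *\<^sub>R 1)" "t \<noteq> 0"
  shows "invertible_elem (y * x + t *\<^sub>R 1)"
proof -
  obtain c where c: "c * (x * y + t *\<^sub>R 1) = 1" "(x * y + t *\<^sub>R 1) * c = 1"
    using assms(1) by (auto simp: invertible_elem_def inverse_pair_def)
  have c': "c * x * y = 1 - t *\<^sub>R c" "x * y * c = 1 - t *\<^sub>R c"
    using c by (simp_all add: algebra_simps)
  \<comment> \<open>Found by expanding the inverse of \<open>t + y * x\<close> as a formal geometric
    series and regrouping it around the inverse \<open>c\<close> of
    \<open>t + x * y\<close>.\<close>
  let ?d = "inverse t *\<^sub>R (1 - y * c * x)"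
  have "?d * (y * x + t *\<^sub>R 1) = inverse t *\<^sub>R (y * x + t *\<^sub>R 1 - (y * (c * x * y) * x + t *\<^sub>R (y * c * x)))"
    by (simp add: algebra_simps)
  also have "\<dots> = 1" unfolding c' using assms(2) by (simp add: algebra_simps)
  finally have l: "?d * (y * x + t *\<^sub>R 1) = 1" .
  have "(y * x + t *\<^sub>R 1) * ?d = inverse t *\<^sub>R (y * x + t *\<^sub>R 1 - (y * (x * y * c) * x + t *\<^sub>R (y * c * x)))"
    by (simp add: algebra_simps)
  also have "\<dots> = 1" unfolding c' using assms(2) by (simp add: algebra_simps)
  finally show ?thesis using l unfolding invertible_elem_def inverse_pair_def by blast
qed

lemma real_imaginary_decomposition:
  fixes x :: "'a::unital_cstar_algebra"
  obtains h k where "star h = h" "star k = k" "x = h + \<i> *\<^sub>C k" "norm h \<le> norm x" "norm k \<le> norm x"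
proof
  let ?h = "(1 / 2) *\<^sub>R (x + star x)" and ?k = "(- \<i> / 2) *\<^sub>C (x - star x)"
  show "star ?h = ?h" by (simp add: star_add add.commute)
  show "star ?k = ?k"
    by (simp add: star_scaleC star_diff complex_vector.scale_right_diff_distrib)
  have "\<i> *\<^sub>C ?k = (1 / 2) *\<^sub>R (x - star x)" by (simp add: scaleC_scaleC scaleR_scaleC)
  then have "?h + \<i> *\<^sub>C ?k = (1 / 2) *\<^sub>R (x + x)" by (simp flip: scaleR_add_right)
  then show "x = ?h + \<i> *\<^sub>C ?k" by (simp flip: scaleR_2)
  show "norm ?h \<le> norm x" using norm_triangle_ineq[of x "star x"] by simp
  show "norm ?k \<le> norm x" using norm_triangle_ineq4[of x "star x"] by (simp add: norm_scaleC norm_divide)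
qed

text \<open>With \<open>z = h + \<i> k\<close> the mixed terms cancel and
  \<open>2 * (h\<^sup>2 + k\<^sup>2)\<close> remains.\<close>

lemma star_mult_self_add_swap_positive:
  fixes z :: "'a::unital_cstar_algebra"
  shows "star z * z + z * star z \<in> positive_cone"
proof -
  obtain h k where z: "star h = h" "star k = k" "z = h + \<i> *\<^sub>C k"
    using real_imaginary_decomposition by metis
  have ii: "\<i> *\<^sub>C \<i> *\<^sub>C u = - u" for u :: 'a by (simp add: scaleC_scaleC scaleC_one)
  have "star z * z + z * star z = 2 *\<^sub>R (h * h + k * k)"
    by (simp add: z star_add star_scaleC mult_scaleC_left mult_scaleC_right algebra_simps scaleR_2 ii)
  then show ?thesis using z positive_cone_square positive_cone_add positive_cone_scaleR
    by (metis zero_le_numeral)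
qed

text \<open>For \<open>y = star x * x\<close> with spectrum above \<open>- m\<close>, put \<open>z = x * w\<close> with \<open>w\<close> the inverse of
  \<open>y + m\<close>.  Then \<open>star z * z = w - m w\<^sup>2 \<le> 1 / (4 m)\<close>; the same bound holds for \<open>z * star z\<close>,
  and hence \<open>star z * z \<ge> - 1 / (4 m)\<close>.\<close>

lemma star_mult_self_spectrum_improvement:
  fixes x :: "'a::unital_cstar_algebra"
  assumes m: "m > 0" and inv: "invertible_elem (star x * x + m *\<^sub>R 1)"
    and u: "0 < u" "2 * u < m"
  shows "invertible_elem (star x * x + (m - u) *\<^sub>R 1)"
proof -
  define p where "p = star x * x + m *\<^sub>R 1"
  obtain w where w: "w * p = 1" "p * w = 1" using inv by (auto simp: p_def invertible_elem_def inverse_pair_def)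
  have sp: "star p = p" by (simp add: p_def star_add star_mult)
  have "star w * p = 1" "p * star w = 1" using w sp by (metis star_mult star_one)+
  then have sw: "star w = w" by (metis w mult.assoc mult.left_neutral mult.right_neutral)
  define z where "z = x * w"
  have zz: "star z * z = w - m *\<^sub>R (w * w)"
  proof -
    have "star z * z = w * (p - m *\<^sub>R 1) * w" by (simp add: z_def p_def star_mult sw mult.assoc)
    then show ?thesis using w by (simp add: algebra_simps)
  qed
  define c where "c = 1 / (4 * m)"
  have c: "c > 0" using m by (simp add: c_def)
  \<comment> \<open>Completes the square: with \<open>c = 1 / (4 m)\<close> this element is
    \<open>c - w + m w\<^sup>2\<close>.\<close>
  have "c *\<^sub>R ((1 - (2 * m) *\<^sub>R w) * (1 - (2 * m) *\<^sub>R w)) \<in> positive_cone"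
    using c sw by (intro positive_cone_scaleR positive_cone_square) (auto simp: star_diff)
  also have "c *\<^sub>R ((1 - (2 * m) *\<^sub>R w) * (1 - (2 * m) *\<^sub>R w)) = c *\<^sub>R 1 - (4 * m * c) *\<^sub>R w + (4 * m * c * m) *\<^sub>R (w * w)"
    by (simp add: algebra_simps) (simp flip: scaleR_add_left add: add.assoc[symmetric])
  also have "\<dots> = c *\<^sub>R 1 - star z * z" using m unfolding zz by (simp add: c_def)
  finally have le: "c *\<^sub>R 1 - star z * z \<in> positive_cone" .
  have "c *\<^sub>R 1 - z * star z \<in> positive_cone"
    unfolding positive_cone_iff
  proof (intro conjI allI impI)
    show "star (c *\<^sub>R 1 - z * star z) = c *\<^sub>R 1 - z * star z" by (simp add: star_diff star_mult)
    fix t :: real assume t: "t > 0"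
    have "invertible_elem (c *\<^sub>R 1 - star z * z + t *\<^sub>R 1)" using le t by (simp add: positive_cone_iff)
    then have "invertible_elem ((- star z) * z + (c + t) *\<^sub>R 1)" by (simp add: algebra_simps)
    then have "invertible_elem (z * (- star z) + (c + t) *\<^sub>R 1)"
      using c t by (intro invertible_elem_swap[of "- star z" z]) auto
    then show "invertible_elem (c *\<^sub>R 1 - z * star z + t *\<^sub>R 1)" by (simp add: algebra_simps)
  qed
  from positive_cone_add[OF this star_mult_self_add_swap_positive[of z]]
  have ge: "star z * z + c *\<^sub>R 1 \<in> positive_cone" by (simp add: algebra_simps)
  \<comment> \<open>\<open>- s\<close> is the value of \<open>w - m w\<^sup>2\<close> at
    \<open>w = 1 / u\<close>, so \<open>star z * z + s\<close> has the factor
    \<open>?v = w - 1 / u\<close>. As \<open>s > c\<close>, it is invertible, hence so is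
    \<open>?v\<close>, and \<open>- u * p * ?v = p - u\<close>.\<close>
  define s where "s = (m - u) / u\<^sup>2"
  have "s > c"
  proof -
    have "u * u < 4 * (m - u) * m" by (rule mult_strict_mono) (use u in auto)
    then have "u\<^sup>2 / (4 * m) < m - u"
      using m by (subst pos_divide_less_eq) (simp_all add: power2_eq_square mult_ac)
    then show ?thesis using u m by (simp add: s_def c_def pos_less_divide_eq)
  qed
  then have "invertible_elem (star z * z + c *\<^sub>R 1 + (s - c) *\<^sub>R 1)"
    using ge by (simp add: positive_cone_iff)
  then have i: "invertible_elem (star z * z + s *\<^sub>R 1)" by (simp add: algebra_simps)
  let ?v = "w - (1 / u) *\<^sub>R 1" and ?q = "(1 - m / u) *\<^sub>R 1 - m *\<^sub>R w"
  have s_eq: "s = - ((1 / u) * (1 - m / u))" using u by (simp add: s_def field_simps power2_eq_square)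
  have "?v * ?q = star z * z + s *\<^sub>R 1" "?q * ?v = star z * z + s *\<^sub>R 1"
    unfolding zz s_eq using u by (simp_all add: algebra_simps)
  then have "invertible_elem ?v" using i invertible_elem_commuting_factor by metis
  moreover have "invertible_elem p" using inv by (simp add: p_def)
  ultimately have "invertible_elem ((- u) *\<^sub>R (p * ?v))"
    using u by (intro invertible_elem_scaleR invertible_elem_mult) auto
  also have "(- u) *\<^sub>R (p * ?v) = p - u *\<^sub>R 1" using w u by (simp add: algebra_simps)
  finally show ?thesis by (simp add: p_def algebra_simps)
qed

text \<open>Let \<open>d > 0\<close> be the supremum of \<open>S\<close>. From the invertible shift
  \<open>m = 3 / 2 * d\<close> the improvement reaches all shifts between
  \<open>m / 2 = 3 / 4 * d\<close> and \<open>m\<close>, among them one in \<open>S\<close>.\<close>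

theorem star_mult_self_positive:
  fixes x :: "'a::unital_cstar_algebra"
  shows "star x * x \<in> positive_cone"
proof -
  let ?y = "star x * x"
  define S where "S = {t. t > 0 \<and> \<not> invertible_elem (?y + t *\<^sub>R 1)}"
  have "S = {}"
  proof (rule ccontr)
    assume ne: "S \<noteq> {}"
    have bdd: "bdd_above S"
    proof (rule bdd_aboveI)
      fix t assume "t \<in> S"
      then have "\<not> norm ?y < \<bar>t\<bar>" and "t > 0" using invertible_elem_plus_scaleR_one unfolding S_def by blast+
      then show "t \<le> norm ?y" by simp
    qed
    define d where "d = Sup S"
    have "d > 0" using ne cSup_upper[OF _ bdd] unfolding d_def S_def by fastforce
    then have "3 / 4 * d < Sup S" unfolding d_def[symmetric] by simp
    then obtain t where t: "t \<in> S" "3 / 4 * d < t" using less_cSup_iff[OF ne bdd] by blast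
    have "t \<le> d" unfolding d_def by (rule cSup_upper[OF t(1) bdd])
    define m where "m = 3 / 2 * d"
    have m: "m > d" "m > 0" using \<open>d > 0\<close> by (auto simp: m_def)
    have "m \<notin> S" using cSup_upper[OF _ bdd, of m] m unfolding d_def by linarith
    then have "invertible_elem (?y + m *\<^sub>R 1)" using m by (simp add: S_def)
    from star_mult_self_spectrum_improvement[OF m(2) this, of "m - t"] \<open>t \<le> d\<close> t(2) m
    have "invertible_elem (?y + t *\<^sub>R 1)" by (simp add: m_def)
    then show False using t by (simp add: S_def)
  qed
  then show ?thesis by (auto simp: positive_cone_iff star_mult S_def)
qed

section \<open>Square roots of \<open>a + e\<close> and commuting products\<close>

lemma square_root_positive_plus_scalar_exists:
  fixes a :: "'a::unital_cstar_algebra"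
  assumes a: "a \<in> positive_cone" and e: "e > 0"
  obtains h where "star h = h" "h * h = a + e *\<^sub>R 1" "\<And>c. c * a = a * c \<Longrightarrow> c * h = h * c"
proof -
  define R where "R = norm a + e"
  have R: "R > 0" using e by (simp add: R_def add_nonneg_pos)
  \<comment> \<open>Scaled so that \<open>a + e = R * (1 + b)\<close>. Positivity of
    \<open>a\<close> gives \<open>norm b \<le> norm a / R < 1\<close>, so the binomial series for
    the square root of \<open>1 + b\<close> converges absolutely.\<close>
  define b where "b = inverse R *\<^sub>R (a - norm a *\<^sub>R 1)"
  have sb: "star b = b" using positive_cone_selfadjoint[OF a] by (simp add: b_def star_diff)
  have "norm (norm a *\<^sub>R 1 - a) \<le> norm a" using a positive_cone_norm_iff by blast
  then have "norm b \<le> norm a / R"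
    using R by (simp add: b_def norm_minus_commute divide_simps)
  also have "\<dots> < 1" using e R by (simp add: R_def divide_simps)
  finally have nb: "norm b < 1" .
  define g where "g n = (1 / 2 gchoose n :: real)" for n
  define f where "f n = g n *\<^sub>R b ^ n" for n
  obtain r where r: "norm b < r" "r < 1" using nb dense by blast
  have r0: "0 < r" using r norm_ge_zero[of b] by linarith
  have "summable (\<lambda>n. g n * r ^ n)"
    using gen_binomial_real[of r "1/2"] r r0 by (auto simp: g_def sums_iff)
  then have s0: "summable (\<lambda>n. norm (g n * norm b ^ n))"
    by (rule powser_insidea) (use r r0 in auto)
  have sn: "summable (\<lambda>n. norm (f n))"
    by (rule summable_comparison_test'[OF s0, of 0])
      (auto simp: f_def abs_mult norm_power_ineq intro!: mult_left_mono)
  have s: "summable f" by (rule summable_norm_cancel[OF sn])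
  define h where "h = suminf f"
  have "star h = (\<Sum>n. star (f n))"
    unfolding h_def by (rule bounded_linear.suminf[OF bounded_linear_star s, symmetric, THEN sym])
  moreover have "star (b ^ n) = b ^ n" for n
    by (induction n) (simp_all add: star_mult sb power_commutes)
  then have "star (f n) = f n" for n by (simp add: f_def)
  ultimately have sh: "star h = h" by (simp add: h_def)
  have comm: "c * h = h * c" if "c * b = b * c" for c
  proof -
    have "c * b ^ n = b ^ n * c" for n
      by (induction n) (simp_all add: that mult.assoc[symmetric], simp add: that mult.assoc)
    then show ?thesis unfolding h_def
      by (simp add: suminf_mult[OF s, symmetric] suminf_mult2[OF s] f_def)
  qed
  \<comment> \<open>Vandermonde's convolution turns the square of the series into one with
    coefficients \<open>1 gchoose k\<close>, which vanish from \<open>k = 2\<close> on.\<close>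
  have "(\<lambda>k. \<Sum>i\<le>k. f i * f (k - i)) sums (h * h)"
    unfolding h_def by (rule Cauchy_product_sums[OF sn sn])
  also have "(\<lambda>k. \<Sum>i\<le>k. f i * f (k - i)) = (\<lambda>k. (1 gchoose k) *\<^sub>R b ^ k)"
  proof
    fix k
    have "(\<Sum>i\<le>k. f i * f (k - i)) = (\<Sum>i\<le>k. (g i * g (k - i)) *\<^sub>R b ^ k)"
      by (intro sum.cong) (simp_all add: f_def flip: power_add)
    also have "\<dots> = (\<Sum>i\<le>k. g i * g (k - i)) *\<^sub>R b ^ k" by (simp add: scaleR_sum_left)
    also have "(\<Sum>i\<le>k. g i * g (k - i)) = (1 gchoose k)"
      unfolding g_def using gbinomial_Vandermonde[of "1/2::real" "1/2" k] by (simp add: atLeast0AtMost)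
    finally show "(\<Sum>i\<le>k. f i * f (k - i)) = (1 gchoose k) *\<^sub>R b ^ k" .
  qed
  finally have "(\<lambda>k. (1 gchoose k) *\<^sub>R b ^ k) sums (h * h)" .
  moreover have "(\<lambda>k. (1 gchoose k) *\<^sub>R b ^ k) sums (\<Sum>k\<in>{0,1}. (1 gchoose k) *\<^sub>R b ^ k)"
  proof (rule sums_finite)
    fix k :: nat assume "k \<notin> {0, 1}"
    then have "(1::real) gchoose k = 0"
      using binomial_gbinomial[of 1 k, where 'a=real] by (cases k) (auto simp: binomial_eq_0)
    then show "(1 gchoose k) *\<^sub>R b ^ k = 0" by simp
  qed simp
  ultimately have hh: "h * h = 1 + b" using sums_unique2 by fastforce
  show thesis
  proof
    show "star (sqrt R *\<^sub>R h) = sqrt R *\<^sub>R h" by (simp add: sh)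
    have "(sqrt R *\<^sub>R h) * (sqrt R *\<^sub>R h) = R *\<^sub>R (1 + b)" using R by (simp add: hh)
    also have "\<dots> = R *\<^sub>R 1 + (a - norm a *\<^sub>R 1)" using R by (simp add: b_def scaleR_add_right)
    also have "\<dots> = a + e *\<^sub>R 1" by (simp add: R_def scaleR_add_left)
    finally show "(sqrt R *\<^sub>R h) * (sqrt R *\<^sub>R h) = a + e *\<^sub>R 1" .
    fix c assume "c * a = a * c"
    then have "c * b = b * c" by (simp add: b_def algebra_simps)
    then show "c * (sqrt R *\<^sub>R h) = sqrt R *\<^sub>R h * c" by (simp add: comm)
  qed
qed

text \<open>For a square root \<open>h\<close> of \<open>a + e\<close>,
  \<open>star x * (a + e) * x\<close> equals \<open>star (h * x) * (h * x)\<close>.\<close>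

lemma positive_cone_conjugate:
  fixes a x :: "'a::unital_cstar_algebra"
  assumes "a \<in> positive_cone"
  shows "star x * a * x \<in> positive_cone"
proof (rule positive_cone_limit)
  show "star (star x * x) = star x * x" by (simp add: star_mult)
  fix e :: real assume "e > 0"
  then obtain h where h: "star h = h" "h * h = a + e *\<^sub>R 1"
    using square_root_positive_plus_scalar_exists[OF assms] by metis
  have "star (h * x) * (h * x) = star x * (h * h) * x" by (simp add: star_mult h(1) mult.assoc)
  also have "\<dots> = star x * a * x + e *\<^sub>R (star x * x)" by (simp add: h(2) algebra_simps)
  finally show "star x * a * x + e *\<^sub>R (star x * x) \<in> positive_cone"
    by (metis star_mult_self_positive)
qed

text \<open>A square root \<open>h\<close> of \<open>a + e\<close> can be taken to commute with
  \<open>b\<close>, so \<open>(a + e) * b\<close> is the conjugate \<open>h * b * h\<close>.\<close>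

lemma positive_cone_mult_commute:
  fixes a b :: "'a::unital_cstar_algebra"
  assumes a: "a \<in> positive_cone" and b: "b \<in> positive_cone" and ab: "a * b = b * a"
  shows "a * b \<in> positive_cone"
proof (rule positive_cone_limit)
  show "star b = b" using b by (rule positive_cone_selfadjoint)
  fix e :: real assume "e > 0"
  then obtain h where h: "star h = h" "h * h = a + e *\<^sub>R 1" "b * h = h * b"
    using square_root_positive_plus_scalar_exists[OF a] ab by metis
  have "star h * b * h = (h * h) * b" by (simp only: h(1,3) mult.assoc)
  also have "\<dots> = a * b + e *\<^sub>R b" by (simp add: h(2) algebra_simps)
  finally show "a * b + e *\<^sub>R b \<in> positive_cone" by (metis positive_cone_conjugate[OF b])
qed

section \<open>Unital positive maps\<close>

context
  fixes T :: "'a::unital_cstar_algebra \<Rightarrow> 'a"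
  assumes lin: "clinear T"
begin

lemma clinear_add: "T (x + y) = T x + T y"
  using module_hom.add[of scaleC scaleC T x y] lin unfolding clinear_def Vector_Spaces.linear_def by blast

lemma clinear_scaleC: "T (c *\<^sub>C x) = c *\<^sub>C T x"
  using module_hom.scale[of scaleC scaleC T c x] lin unfolding clinear_def Vector_Spaces.linear_def by blast

lemma clinear_scaleR: "T (r *\<^sub>R x) = r *\<^sub>R T x"
  by (simp add: scaleR_scaleC clinear_scaleC)

lemma clinear_minus: "T (- x) = - T x"
  using clinear_scaleR[of "-1" x] by simp

lemma clinear_diff: "T (x - y) = T x - T y"
  using clinear_add[of x "- y"] by (simp add: clinear_minus)

end

lemma clinearI:
  assumes "\<And>x y. T (x + y) = T x + T y" "\<And>c x. T (c *\<^sub>C x) = c *\<^sub>C T x"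
  shows "clinear (T :: 'a::unital_cstar_algebra \<Rightarrow> 'a)"
  unfolding clinear_def
  by (intro Vector_Spaces.linear.intro module_hom.intro module_hom_axioms.intro
      complex_vector.vector_space_axioms complex_vector.module_axioms assms)

lemma clinear_inv:
  assumes "clinear T" "bij T"
  shows "clinear (inv T)"
proof (rule clinearI)
  have T: "T (inv T x) = x" for x using assms(2) by (simp add: bij_is_surj surj_f_inv_f)
  show "inv T (x + y) = inv T x + inv T y" for x y
    using assms(2) by (intro inv_f_eq bij_is_inj) (simp_all add: clinear_add[OF assms(1)] T)
  show "inv T (c *\<^sub>C x) = c *\<^sub>C inv T x" for c x
    using assms(2) by (intro inv_f_eq bij_is_inj) (simp_all add: clinear_scaleC[OF assms(1)] T)
qed

section \<open>Boundedness and Kadison's inequality\<close>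

locale unital_positive_map =
  fixes T :: "'a::unital_cstar_algebra \<Rightarrow> 'a"
  assumes lin: "clinear T"
    and pos: "a \<in> positive_cone \<Longrightarrow> T a \<in> positive_cone"
    and unital: "T 1 = 1"
begin

lemmas linear_simps = clinear_add[OF lin] clinear_scaleC[OF lin] clinear_scaleR[OF lin]
  clinear_minus[OF lin] clinear_diff[OF lin] unital

lemma selfadjoint:
  assumes "star a = a"
  shows "star (T a) = T a"
proof -
  have "norm a *\<^sub>R 1 + a \<in> positive_cone" by (rule positive_cone_scalar_plus_selfadjoint[OF assms]) simp
  from positive_cone_selfadjoint[OF pos[OF this]] show ?thesis by (simp add: linear_simps star_add)
qed

lemma star_commute: "T (star x) = star (T x)"
proof -
  obtain h k where "star h = h" "star k = k" "x = h + \<i> *\<^sub>C k"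
    using real_imaginary_decomposition by metis
  then show ?thesis using selfadjoint by (simp add: star_add star_scaleC linear_simps)
qed

lemma norm_selfadjoint_le:
  assumes "star a = a"
  shows "norm (T a) \<le> norm a"
proof (rule selfadjoint_norm_le)
  have "norm a *\<^sub>R 1 + a \<in> positive_cone" "norm a *\<^sub>R 1 + - a \<in> positive_cone"
    by (rule positive_cone_scalar_plus_selfadjoint; simp add: assms)+
  from this[THEN pos] show "norm a *\<^sub>R 1 + T a \<in> positive_cone" "norm a *\<^sub>R 1 - T a \<in> positive_cone"
    by (simp_all add: linear_simps)
qed (simp_all add: selfadjoint assms)

text \<open>Self-adjoint elements are contracted; the factor 2 is the price of splitting
  \<open>x\<close> into two of them.\<close>

lemma norm_le_twice: "norm (T x) \<le> 2 * norm x"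
proof -
  obtain h k where h: "star h = h" "star k = k" "x = h + \<i> *\<^sub>C k" "norm h \<le> norm x" "norm k \<le> norm x"
    using real_imaginary_decomposition by metis
  have "norm (T x) \<le> norm (T h) + norm (\<i> *\<^sub>C T k)"
    unfolding h(3) linear_simps by (rule norm_triangle_ineq)
  also have "\<dots> \<le> norm h + norm k"
    using h norm_selfadjoint_le by (simp add: norm_scaleC add_mono)
  finally show ?thesis using h by simp
qed

text \<open>The arguments of \<open>F\<close> are the moments of order 0, 1 and 2 of \<open>r + Bin(n, a)\<close>, weighted by \<open>Q\<close>.
  They are sums of triples \<open>P\<close>, \<open>t P\<close>, \<open>t\<^sup>2 P\<close> with \<open>P \<ge> 0\<close> and \<open>t\<close> real, on which \<open>F\<close> takes the
  value \<open>(t - b) (T P) (t - b)\<close>.  The induction step conditions on one trial.\<close>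

lemma binomial_moments_positive:
  fixes b a Q :: 'a and r :: real
  assumes b: "star b = b" and a: "a \<in> positive_cone" "1 - a \<in> positive_cone"
    and "Q \<in> positive_cone" "a * Q = Q * a"
  defines "F \<equiv> \<lambda>A0 A1 A2. T A2 - b * T A1 - T A1 * b + b * T A0 * b"
  shows "F Q (r *\<^sub>R Q + real n *\<^sub>R (a * Q))
    (r\<^sup>2 *\<^sub>R Q + (2 * r * n + n) *\<^sub>R (a * Q) + (real n * (real n - 1)) *\<^sub>R (a * a * Q)) \<in> positive_cone"
  using assms(4,5)
proof (induction n arbitrary: r Q)
  case 0
  have "star (r *\<^sub>R 1 - b) * T Q * (r *\<^sub>R 1 - b) \<in> positive_cone"
    by (rule positive_cone_conjugate[OF pos[OF 0(1)]])
  also have "star (r *\<^sub>R 1 - b) * T Q * (r *\<^sub>R 1 - b) = F Q (r *\<^sub>R Q) (r\<^sup>2 *\<^sub>R Q)"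
    by (simp add: F_def star_diff b linear_simps algebra_simps power2_eq_square)
  finally show ?case by simp
next
  case (Suc n)
  have F_add: "F (A0 + B0) (A1 + B1) (A2 + B2) = F A0 A1 A2 + F B0 B1 B2" for A0 A1 A2 B0 B1 B2
    by (simp add: F_def linear_simps algebra_simps)
  have "a * (Q * a) = Q * (a * a)" by (simp add: Suc.prems(2) flip: mult.assoc)
  then have c: "a * (a * Q) = (a * Q) * a" "a * ((1 - a) * Q) = ((1 - a) * Q) * a"
      "(1 - a) * Q = Q * (1 - a)"
    using Suc.prems(2) by (simp_all add: algebra_simps)
  have p: "a * Q \<in> positive_cone" "(1 - a) * Q \<in> positive_cone"
    using positive_cone_mult_commute a Suc.prems c by blast+
  \<comment> \<open>Success carries weight \<open>a * Q\<close> and raises \<open>r\<close> to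
    \<open>r + 1\<close>; failure carries weight \<open>(1 - a) * Q\<close> and keeps
    \<open>r\<close>. As \<open>F\<close> is additive, the two cases sum to the moments for
    \<open>Suc n\<close>.\<close>
  note IH = positive_cone_add[OF Suc.IH[OF p(1) c(1), of "r + 1"] Suc.IH[OF p(2) c(2), of r]]
  have e0: "a * Q + (1 - a) * Q = Q" by (simp add: algebra_simps)
  have e1: "((r + 1) *\<^sub>R (a * Q) + real n *\<^sub>R (a * (a * Q))) + (r *\<^sub>R ((1 - a) * Q) + real n *\<^sub>R (a * ((1 - a) * Q)))
    = r *\<^sub>R Q + real (Suc n) *\<^sub>R (a * Q)"
    by (simp add: algebra_simps)
  have coeffs: "(r + 1)\<^sup>2 - r\<^sup>2 + (2 * r * real n + real n) = 2 * r * real (Suc n) + real (Suc n)"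
      "(2 * (r + 1) * real n + real n) - (2 * r * real n + real n) + real n * (real n - 1) = real (Suc n) * (real (Suc n) - 1)"
    by (simp_all add: algebra_simps power2_eq_square)
  have regroup: "(p *\<^sub>R (a * Q) + q *\<^sub>R (a * (a * Q)) + u *\<^sub>R (a * a * (a * Q)))
     + (v *\<^sub>R ((1 - a) * Q) + w *\<^sub>R (a * ((1 - a) * Q)) + u *\<^sub>R (a * a * ((1 - a) * Q)))
    = v *\<^sub>R Q + (p - v + w) *\<^sub>R (a * Q) + (q - w + u) *\<^sub>R (a * a * Q)" for p q u v w
    by (simp add: algebra_simps)
  have e2: "((r + 1)\<^sup>2 *\<^sub>R (a * Q) + (2 * (r + 1) * real n + real n) *\<^sub>R (a * (a * Q)) + (real n * (real n - 1)) *\<^sub>R (a * a * (a * Q)))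
     + (r\<^sup>2 *\<^sub>R ((1 - a) * Q) + (2 * r * real n + real n) *\<^sub>R (a * ((1 - a) * Q)) + (real n * (real n - 1)) *\<^sub>R (a * a * ((1 - a) * Q)))
    = r\<^sup>2 *\<^sub>R Q + (2 * r * real (Suc n) + real (Suc n)) *\<^sub>R (a * Q) + (real (Suc n) * (real (Suc n) - 1)) *\<^sub>R (a * a * Q)"
    unfolding regroup coeffs ..
  show ?case using IH unfolding F_add[symmetric] e0 e1 e2 .
qed

text \<open>For \<open>Q = 1\<close>, \<open>r = 0\<close> and \<open>b = n T a\<close>, the image
  of the mean, the moment lemma says that a variance is positive. Dividing by
  \<open>n\<^sup>2\<close> gives \<open>T a / n + (1 - 1 / n) T (a * a) - T a * T a \<ge> 0\<close>,
  and \<open>n\<close> tends to infinity.\<close>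

lemma kadison_inequality_contraction:
  assumes a: "a \<in> positive_cone" "1 - a \<in> positive_cone"
  shows "T (a * a) - T a * T a \<in> positive_cone"
proof (rule positive_cone_limit)
  have sa: "star a = a" by (rule positive_cone_selfadjoint[OF a(1)])
  show "star (T a) = T a" by (rule selfadjoint[OF sa])
  fix e :: real assume "e > 0"
  obtain n :: nat where n: "n > 0" "1 / real n < e"
    using \<open>e > 0\<close> ex_inverse_of_nat_less by (metis inverse_eq_divide)
  define d where "d = 1 / real n"
  have d: "d > 0" "d < e" "d * n = 1" using n by (auto simp: d_def)
  define b where "b = real n *\<^sub>R T a"
  have "star b = b" using selfadjoint[OF sa] by (simp add: b_def)
  from binomial_moments_positive[OF this a positive_cone_one, of 0 n]
  have "d\<^sup>2 *\<^sub>R (real n *\<^sub>R T a + (real n * (real n - 1)) *\<^sub>R T (a * a) - b * b) \<in> positive_cone"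
    by (intro positive_cone_scaleR) (simp_all add: linear_simps b_def)
  also have "d\<^sup>2 *\<^sub>R (real n *\<^sub>R T a + (real n * (real n - 1)) *\<^sub>R T (a * a) - b * b)
      = (d * (d * n)) *\<^sub>R T a + ((d * n) * (d * n - d)) *\<^sub>R T (a * a) - ((d * n) * (d * n)) *\<^sub>R (T a * T a)"
    by (simp add: b_def algebra_simps power2_eq_square)
  also have "\<dots> = d *\<^sub>R T a + (1 - d) *\<^sub>R T (a * a) - T a * T a" by (simp add: d)
  finally have 1: "d *\<^sub>R T a + (1 - d) *\<^sub>R T (a * a) - T a * T a \<in> positive_cone" .
  have 2: "d *\<^sub>R T (a * a) \<in> positive_cone"
    using d by (intro positive_cone_scaleR pos positive_cone_square sa) auto
  have 3: "(e - d) *\<^sub>R T a \<in> positive_cone"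
    using d by (intro positive_cone_scaleR pos a) auto
  show "T (a * a) - T a * T a + e *\<^sub>R T a \<in> positive_cone"
    using positive_cone_add[OF positive_cone_add[OF 1 2] 3] by (simp add: algebra_simps)
qed

text \<open>The difference is unchanged by adding real multiples of 1 to \<open>a\<close> and scales
  quadratically, so \<open>a\<close> may be moved between 0 and 1 as
  \<open>c = 1 / 2 + s * a\<close>.\<close>

theorem kadison_inequality:
  assumes a: "star a = a"
  shows "T (a * a) - T a * T a \<in> positive_cone"
proof -
  define r where "r = norm a + 1"
  have r: "r > 0" "norm a \<le> r" by (auto simp: r_def add_nonneg_pos)
  define s where "s = inverse (2 * r)"
  have s: "s * r = 1 / 2" "s > 0" using r by (auto simp: s_def)
  have "s *\<^sub>R (r *\<^sub>R 1 + a) \<in> positive_cone" "s *\<^sub>R (r *\<^sub>R 1 + - a) \<in> positive_cone"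
    by (rule positive_cone_scaleR[OF positive_cone_scalar_plus_selfadjoint]; use r s a in simp)+
  moreover define c where "c = s *\<^sub>R (r *\<^sub>R 1 + a)"
  moreover have c: "c = (1 / 2) *\<^sub>R 1 + s *\<^sub>R a" using s by (simp add: c_def scaleR_add_right)
  moreover have "s *\<^sub>R (r *\<^sub>R 1 + - a) = (1 - 1 / 2) *\<^sub>R 1 - s *\<^sub>R a"
    using s by (simp add: scaleR_diff_right)
  then have "s *\<^sub>R (r *\<^sub>R 1 + - a) = 1 - c"
    unfolding c scaleR_diff_left by simp
  ultimately have "T (c * c) - T c * T c \<in> positive_cone"
    by (intro kadison_inequality_contraction) simp_all
  also have "T (c * c) - T c * T c = s\<^sup>2 *\<^sub>R (T (a * a) - T a * T a)"
    by (simp add: c linear_simps algebra_simps power2_eq_square)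
  finally have "inverse (s\<^sup>2) *\<^sub>R s\<^sup>2 *\<^sub>R (T (a * a) - T a * T a) \<in> positive_cone"
    by (rule positive_cone_scaleR) simp
  then show ?thesis using s by simp
qed

end

section \<open>Order isomorphisms: Jordan structure and isometry\<close>

locale unital_order_isomorphism = unital_positive_map T + inv: unital_positive_map "inv T"
  for T :: "'a::unital_cstar_algebra \<Rightarrow> 'a" +
  assumes bij: "bij T"
begin

lemma inv_left [simp]: "inv T (T x) = x"
  using bij by (simp add: bij_is_inj)

lemma inv_right [simp]: "T (inv T x) = x"
  using bij by (simp add: bij_is_surj surj_f_inv_f)

text \<open>Kadison's inequality for \<open>inv T\<close> at \<open>T a\<close>, pushed forward by
  \<open>T\<close>, reverses the one for \<open>T\<close> at \<open>a\<close>.\<close>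

lemma jordan_square_selfadjoint:
  assumes "star a = a"
  shows "T (a * a) = T a * T a"
proof -
  have "T (inv T (T a * T a) - a * a) \<in> positive_cone"
    using inv.kadison_inequality[of "T a"] selfadjoint[OF assms] pos by simp
  then have "- (T (a * a) - T a * T a) \<in> positive_cone" by (simp add: linear_simps)
  from positive_cone_antisym[OF kadison_inequality[OF assms] this] show ?thesis by simp
qed

lemma jordan_product_selfadjoint:
  assumes "star a = a" "star b = b"
  shows "T (a * b + b * a) = T a * T b + T b * T a"
proof -
  have "T ((a + b) * (a + b)) = T (a + b) * T (a + b)"
    by (rule jordan_square_selfadjoint) (simp add: star_add assms)
  then show ?thesis
    using jordan_square_selfadjoint[OF assms(1)] jordan_square_selfadjoint[OF assms(2)]
    by (simp add: linear_simps algebra_simps)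
qed

lemma jordan_product: "T (x * y + y * x) = T x * T y + T y * T x"
proof -
  obtain h k where x: "star h = h" "star k = k" "x = h + \<i> *\<^sub>C k"
    using real_imaginary_decomposition by metis
  obtain h' k' where y: "star h' = h'" "star k' = k'" "y = h' + \<i> *\<^sub>C k'"
    using real_imaginary_decomposition by metis
  have ex: "(p + \<i> *\<^sub>C q) * (p' + \<i> *\<^sub>C q') + (p' + \<i> *\<^sub>C q') * (p + \<i> *\<^sub>C q)
      = (p * p' + p' * p) + \<i> *\<^sub>C (p * q' + q' * p) + \<i> *\<^sub>C (q * p' + p' * q) + \<i> *\<^sub>C \<i> *\<^sub>C (q * q' + q' * q)"
    for p q p' q' :: 'a
    by (simp add: algebra_simps mult_scaleC_left mult_scaleC_right scaleC_add_right)
  show ?thesis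
    unfolding x(3) y(3) ex
    by (simp only: clinear_add[OF lin, of _ "\<i> *\<^sub>C _"] clinear_scaleC[OF lin] ex
        jordan_product_selfadjoint x(1,2) y(1,2))
qed

text \<open>The identity \<open>e\<close> builds \<open>p * q * p\<close> from Jordan products
  alone.\<close>

lemma jordan_triple: "T (x * y * x) = T x * T y * T x"
proof -
  have sq: "T (x * x) = T x * T x" for x
    using jordan_product[of x x] by (simp add: linear_simps flip: scaleR_2)
  have e: "2 *\<^sub>R (p * q * p) = (p * (p * q + q * p) + (p * q + q * p) * p) - ((p * p) * q + q * (p * p))"
    for p q :: 'a
    by (simp add: algebra_simps scaleR_2)
  have "2 *\<^sub>R T (x * y * x) = 2 *\<^sub>R (T x * T y * T x)"
    unfolding clinear_scaleR[OF lin, symmetric] unfolding e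
    by (simp only: clinear_diff[OF lin] jordan_product sq)
  then show ?thesis by simp
qed

lemma norm_le: "norm (T x) \<le> norm x"
proof (rule ccontr)
  assume "\<not> norm (T x) \<le> norm x"
  then have lt: "norm x < norm (T x)" by simp
  define c where "c y = y * star y * y" for y :: 'a
  have norm_c: "norm (c y) = norm y ^ 3" for y
  proof -
    define p where "p = star y * y"
    have sp: "star p = p" "star (p * p) = p * p" by (simp_all add: p_def star_mult)
    have np: "norm p = (norm y)\<^sup>2" by (simp add: p_def cstar_identity)
    \<comment> \<open>The lower bound comes from
      \<open>norm p ^ 4 = norm (p ^ 4) \<le> norm p * norm (p ^ 3)\<close>, using the C*-identity
      twice.\<close>
    have "norm (p * (p * p)) = norm p ^ 3"
    proof (rule antisym)
      show "norm (p * (p * p)) \<le> norm p ^ 3"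
        using norm_mult_ineq[of p "p * p"] norm_square_selfadjoint[OF sp(1)]
        by (simp add: power3_eq_cube power2_eq_square)
      have "norm p * norm p ^ 3 = norm (p * p * (p * p))"
        using norm_square_selfadjoint[OF sp(1)] norm_square_selfadjoint[OF sp(2)]
        by (simp add: power3_eq_cube power2_eq_square)
      also have "\<dots> \<le> norm p * norm (p * (p * p))"
        using norm_mult_ineq[of p "p * (p * p)"] by (simp add: mult.assoc)
      finally show "norm p ^ 3 \<le> norm (p * (p * p))"
        by (cases "p = 0") simp_all
    qed
    moreover have "star (c y) * c y = p * (p * p)" by (simp add: c_def p_def star_mult mult.assoc)
    ultimately have "(norm (c y))\<^sup>2 = (norm y ^ 3)\<^sup>2"
      using cstar_identity[of "c y"] by (simp add: np flip: power_mult)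
    then show ?thesis by (rule power2_eq_imp_eq) simp_all
  qed
  have T_c: "T (c y) = c (T y)" for y by (simp add: c_def jordan_triple star_commute)
  \<comment> \<open>\<open>T\<close> commutes with \<open>c\<close>, whose iterates raise norms to
    the powers \<open>3 ^ n\<close>, while the constant 2 stays fixed. So the powers of
    \<open>norm (T x) / norm x\<close> stay bounded.\<close>
  have bound: "norm (T x) ^ 3 ^ n \<le> 2 * norm x ^ 3 ^ n" for n
  proof -
    have "norm ((c ^^ n) y) = norm y ^ 3 ^ n" for y
      by (induction n) (simp_all add: norm_c mult.commute flip: power_mult)
    moreover have "T ((c ^^ n) x) = (c ^^ n) (T x)" by (induction n) (simp_all add: T_c)
    ultimately show ?thesis using norm_le_twice[of "(c ^^ n) x"] by metis
  qed
  show False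
  proof (cases "x = 0")
    case True
    then show False using lt norm_le_twice[of x] by simp
  next
    case False
    define q where "q = norm (T x) / norm x"
    have q: "q > 1" using lt False by (simp add: q_def)
    then obtain n where n: "2 < q ^ n" using real_arch_pow by blast
    have "n \<le> 3 ^ n" by (rule order.trans[OF less_imp_le[OF less_exp]]) (simp add: power_mono)
    then have "q ^ n \<le> q ^ 3 ^ n" using q by (intro power_increasing) auto
    moreover have "q ^ 3 ^ n \<le> 2"
      using bound[of n] False by (simp add: q_def power_divide divide_simps)
    ultimately show False using n by simp
  qed
qed

end

lemma unital_order_isomorphism_inv:
  assumes "unital_order_isomorphism T"
  shows "unital_order_isomorphism (inv T)"
proof -
  interpret unital_order_isomorphism T by fact
  show ?thesis
    using bij bij_imp_bij_inv inv_inv_eq[OF bij] unital_positive_map_axioms inv.unital_positive_map_axioms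
    by (simp add: unital_order_isomorphism_def unital_order_isomorphism_axioms_def)
qed

lemma unital_order_isomorphism_norm:
  assumes "unital_order_isomorphism T"
  shows "norm (T x) = norm x"
proof (rule antisym)
  interpret unital_order_isomorphism T by fact
  interpret i: unital_order_isomorphism "inv T" using assms by (rule unital_order_isomorphism_inv)
  show "norm (T x) \<le> norm x" by (rule norm_le)
  show "norm x \<le> norm (T x)" using i.norm_le[of "T x"] by simp
qed

section \<open>The spectral condition and the equivalence\<close>

lemma zero_not_in_op_spectrum_iff:
  "0 \<notin> op_spectrum T \<longleftrightarrow> bij T \<and> bounded_clinear (inv T)"
proof
  assume "0 \<notin> op_spectrum T"
  then obtain S where S: "bounded_clinear S" "S \<circ> T = id" "T \<circ> S = id"
    by (auto simp: op_spectrum_def)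
  then have "bij T" using o_bij by blast
  moreover have "inv T = S" using S inv_unique_comp by blast
  ultimately show "bij T \<and> bounded_clinear (inv T)" using S by simp
next
  assume "bij T \<and> bounded_clinear (inv T)"
  then show "0 \<notin> op_spectrum T"
    by (auto simp: op_spectrum_def bij_is_inj bij_is_surj surj_iff[symmetric] intro!: exI[of _ "inv T"])
qed

theorem proposition5p1:
  fixes T :: "'a::unital_cstar_algebra \<Rightarrow> 'a"
  assumes "positive_operator T"
    and "unital_operator T"
  shows "(0 \<notin> op_spectrum T \<and> positive_operator (inv T)) \<longleftrightarrow> (bij T \<and> isometry T)"
proof -
  interpret unital_positive_map T
    using assms by unfold_locales (auto simp: positive_operator_def unital_operator_def)
  have inv1: "inv T 1 = 1" if "bij T" using that unital by (metis bij_inv_eq_iff)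
  show ?thesis
  proof (intro iffI conjI; elim conjE)
    assume "0 \<notin> op_spectrum T" and p: "positive_operator (inv T)"
    then show b: "bij T" by (simp add: zero_not_in_op_spectrum_iff)
    have "unital_order_isomorphism T"
      using p b inv1 by unfold_locales (auto simp: positive_operator_def)
    from unital_order_isomorphism_norm[OF this] show "isometry T"
      by (simp add: isometry_def dist_norm flip: linear_simps)
  next
    assume b: "bij T" and iso: "isometry T"
    have linv: "clinear (inv T)" by (rule clinear_inv[OF lin b])
    have r: "T (inv T x) = x" for x using b by (simp add: bij_is_surj surj_f_inv_f)
    have "T 0 = 0" using linear_simps(3)[of 0 0] by simp
    then have "norm (T x) = norm x" for x using iso unfolding isometry_def by (metis dist_0_norm)
    then have ninv: "norm (inv T x) = norm x" for x by (metis r)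
    then have "bounded_clinear (inv T)" using linv by (auto simp: bounded_clinear_def intro!: exI[of _ 1])
    then show "0 \<notin> op_spectrum T" using b by (simp add: zero_not_in_op_spectrum_iff)
    have "inv T a \<in> positive_cone" if a: "a \<in> positive_cone" for a
    proof -
      have "star (inv T a) = inv T a"
        using b positive_cone_selfadjoint[OF a] star_commute r by (metis bij_inv_eq_iff)
      \<comment> \<open>\<open>inv T\<close> is unital and preserves norms, so the metric
        description of positivity carries over from \<open>a\<close> to \<open>inv T a\<close> with
        the same radius \<open>norm a\<close>.\<close>
      moreover have "norm (norm a *\<^sub>R 1 - inv T a) \<le> norm a"
      proof -
        have "norm a *\<^sub>R 1 - inv T a = inv T (norm a *\<^sub>R 1 - a)"
          by (simp add: clinear_diff[OF linv] clinear_scaleR[OF linv] inv1[OF b])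
        then show ?thesis using a positive_cone_norm_iff[of a "norm a"] by (simp add: ninv)
      qed
      ultimately show ?thesis by (simp add: positive_cone_norm_iff[of _ "norm a"] ninv)
    qed
    then show "positive_operator (inv T)" using linv by (auto simp: positive_operator_def)
  qed
qed

end
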